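(* Let $m,n\geq 2$ and let $D_{m,n}$ be the double-tailed diamond poset with elements $a_1,\dots,a_{m-1},u,v,b_1,\dots,b_{n-1}$, whose cover relations are: $a_j$ covers $a_{j+1}$ for $1\le j\le m-2$; $a_{m-1}$ covers $u$ and $v$; $u$ and $v$ both cover $b_1$; $b_j$ covers $b_{j+1}$ for $1\le j\le n-2$. (So $u,v$ is the unique pair of incomparable elements.) Let $\sigma$ be the linear extension of $D_{m,n}$ with $\sigma(b_{n-j})=j$ for $1\le j\le n-1$, $\sigma(v)=n$, $\sigma(u)=n+1$, and $\sigma(a_{m-j})=n+1+j$ for $1\le j\le m-1$. For $\pi=\pi_1\pi_2\cdots\pi_{m+n}\in\mathcal{S}_{m+n}$, consider the initial labeling that assigns $\pi_j$ to the element $\sigma^{-1}(m+n+1-j)$ (i.e. $a_j\mapsto \pi_j$ for $j\le m-1$, $u\mapsto \pi_m$, $v\mapsto\pi_{m+1}$, $b_j\mapsto \pi_{m+1+j}$), and run jeu de taquin with respect to $\sigma$ on it (as described in the context). The output is one of the two dual linear extensions $T_1,T_2$ of $D_{m,n}$, where both give $a_j$ the label $j$ ($j\le m-1$) and $b_j$ the label $m+1+j$ ($j\le n-1$), and $T_1$ labels $u$ by $m$ and $v$ by $m+1$, while $T_2$ labels $u$ by $m+1$ and $v$ by $m$. Let $s^{(1)}_{m,n}$ (resp. $s^{(2)}_{m,n}$) be the number of permutations $\pi\in\mathcal{S}_{m+n}$ that jeu de taquin maps to $T_1$ (resp. $T_2$). Then \[ s^{(1)}_{m,n}-s^{(2)}_{m,n}=(-1)^m\binom{n-1}{m}\,m!\,n!.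 \] In particular, $s^{(1)}_{m,n}=s^{(2)}_{m,n}$ if and only if $m\geq n$.
   Context: A labeling of a finite poset $P$ with $N$ elements is a bijection $P\to[N]=\{1,\dots,N\}$. A dual linear extension is a labeling $\iota$ with $\iota(x)>\iota(y)$ whenever $x<y$. A linear extension $\sigma:P\to[N]$ is a bijection with $\sigma(x)<\sigma(y)$ whenever $x<y$. Jeu de taquin with respect to a linear extension $\sigma$: starting from a labeling, perform $N$ rounds; in round $i$ let $x:=\sigma^{-1}(i)$. Compare the current label of $x$ with the current labels of all elements covered by $x$. If the label of $x$ is smaller than all of them (or $x$ covers nothing), round $i$ ends. Otherwise, let $y$ be the element covered by $x$ having the smallest label; swap the labels of $x$ and $y$, and repeat this comparison step with $y$ in place of $x$ (i.e. follow the moved label). After all $N$ rounds the labeling is a dual linear extension. *)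

theory Defs
  imports Complex_Main "HOL-Library.While_Combinator" "HOL-Combinatorics.Permutations"
begin

text \<open>A poset is a carrier \<open>P\<close> with \<open>r :: ('a \<times> 'a) set\<close> such that \<open>partial_order_on P r\<close>;
  \<open>(x, y) \<in> r\<close> means \<open>x \<le> y\<close>. Labelings are functions on the whole type of which only the
  values on \<open>P\<close> matter.\<close>

definition labeling :: "'a set \<Rightarrow> ('a \<Rightarrow> nat) \<Rightarrow> bool" where
  "labeling P L \<longleftrightarrow> bij_betw L P {1..card P}"

definition linear_extension :: "'a set \<Rightarrow> ('a \<times> 'a) set \<Rightarrow> ('a \<Rightarrow> nat) \<Rightarrow> bool" where
  "linear_extension P r L \<longleftrightarrow>
     labeling P L \<and> (\<forall>x\<in>P. \<forall>y\<in>P. (x, y) \<in> r \<and> x \<noteq> y \<longrightarrow> L x < L y)"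

definition dual_linear_extension :: "'a set \<Rightarrow> ('a \<times> 'a) set \<Rightarrow> ('a \<Rightarrow> nat) \<Rightarrow> bool" where
  "dual_linear_extension P r L \<longleftrightarrow>
     labeling P L \<and> (\<forall>x\<in>P. \<forall>y\<in>P. (x, y) \<in> r \<and> x \<noteq> y \<longrightarrow> L x > L y)"

definition covered_by :: "('a \<times> 'a) set \<Rightarrow> 'a \<Rightarrow> 'a set" where
  "covered_by r x =
     {y. (y, x) \<in> r \<and> y \<noteq> x \<and> \<not> (\<exists>z. (y, z) \<in> r \<and> z \<noteq> y \<and> (z, x) \<in> r \<and> z \<noteq> x)}"

text \<open>One round: the first component of the state is the current position of the moving label.\<close>

definition jdt_round :: "('a \<times> 'a) set \<Rightarrow> 'a \<Rightarrow> ('a \<Rightarrow> nat) \<Rightarrow> ('a \<Rightarrow> nat)" where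
  "jdt_round r x L = snd (while
     (\<lambda>(x, L). \<not> (\<forall>y\<in>covered_by r x. L x < L y))
     (\<lambda>(x, L). let y = arg_min_on L (covered_by r x) in (y, L(x := L y, y := L x)))
     (x, L))"

definition jdt :: "'a set \<Rightarrow> ('a \<times> 'a) set \<Rightarrow> ('a \<Rightarrow> nat) \<Rightarrow> ('a \<Rightarrow> nat) \<Rightarrow> ('a \<Rightarrow> nat)" where
  "jdt P r \<sigma> L = fold (\<lambda>i. jdt_round r (inv_into P \<sigma> i)) [1..<Suc (card P)] L"


datatype dd = A nat | U | V | B nat

definition dd_elems :: "nat \<Rightarrow> nat \<Rightarrow> dd set" where
  "dd_elems m n = A ` {1..m - 1} \<union> {U, V} \<union> B ` {1..n - 1}"

text \<open>The pairs \<open>(x, y)\<close> such that \<open>x\<close> covers \<open>y\<close> (see lemma \<open>covered_by_dd_order\<close>).\<close>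

definition dd_cover :: "nat \<Rightarrow> nat \<Rightarrow> (dd \<times> dd) set" where
  "dd_cover m n =
     {(A j, A (j + 1)) | j. 1 \<le> j \<and> j + 2 \<le> m} \<union>
     {(A (m - 1), U), (A (m - 1), V), (U, B 1), (V, B 1)} \<union>
     {(B j, B (j + 1)) | j. 1 \<le> j \<and> j + 2 \<le> n}"

definition dd_order :: "nat \<Rightarrow> nat \<Rightarrow> (dd \<times> dd) set" where
  "dd_order m n = ((dd_cover m n)\<inverse>)\<^sup>+ \<union> Id_on (dd_elems m n)"

text \<open>On \<open>dd_elems m n\<close> the subtractions below do not truncate, and the equations are
  \<open>\<sigma> (B (n - j)) = j\<close> and \<open>\<sigma> (A (m - j)) = n + 1 + j\<close> after reindexing.\<close>

fun dd_sigma :: "nat \<Rightarrow> nat \<Rightarrow> dd \<Rightarrow> nat" where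
  "dd_sigma m n (B i) = n - i"
| "dd_sigma m n V = n"
| "dd_sigma m n U = n + 1"
| "dd_sigma m n (A i) = n + 1 + (m - i)"

text \<open>The labeling that assigns \<open>\<pi> j\<close> to the element of \<open>\<sigma>\<close>-value \<open>m + n + 1 - j\<close>
  (see lemma \<open>dd_init_eq\<close>).\<close>

definition dd_init :: "nat \<Rightarrow> nat \<Rightarrow> (nat \<Rightarrow> nat) \<Rightarrow> dd \<Rightarrow> nat" where
  "dd_init m n \<pi> x = \<pi> (m + n + 1 - dd_sigma m n x)"

definition dd_jdt :: "nat \<Rightarrow> nat \<Rightarrow> (nat \<Rightarrow> nat) \<Rightarrow> dd \<Rightarrow> nat" where
  "dd_jdt m n \<pi> = jdt (dd_elems m n) (dd_order m n) (dd_sigma m n) (dd_init m n \<pi>)"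

fun T1 :: "nat \<Rightarrow> dd \<Rightarrow> nat" where
  "T1 m (A j) = j"
| "T1 m U = m"
| "T1 m V = m + 1"
| "T1 m (B j) = m + 1 + j"

fun T2 :: "nat \<Rightarrow> dd \<Rightarrow> nat" where
  "T2 m (A j) = j"
| "T2 m U = m + 1"
| "T2 m V = m"
| "T2 m (B j) = m + 1 + j"

definition dd_maps_to :: "nat \<Rightarrow> nat \<Rightarrow> (nat \<Rightarrow> nat) \<Rightarrow> (dd \<Rightarrow> nat) \<Rightarrow> bool" where
  "dd_maps_to m n \<pi> T \<longleftrightarrow> (\<forall>x\<in>dd_elems m n. dd_jdt m n \<pi> x = T x)"

definition s1 :: "nat \<Rightarrow> nat \<Rightarrow> nat" where
  "s1 m n = card {\<pi>. \<pi> permutes {1..m + n} \<and> dd_maps_to m n \<pi> (T1 m)}"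

definition s2 :: "nat \<Rightarrow> nat \<Rightarrow> nat" where
  "s2 m n = card {\<pi>. \<pi> permutes {1..m + n} \<and> dd_maps_to m n \<pi> (T2 m)}"


lemma dd_elems_simps [simp]:
  "A j \<in> dd_elems m n \<longleftrightarrow> 1 \<le> j \<and> j < m"
  "U \<in> dd_elems m n"
  "V \<in> dd_elems m n"
  "B j \<in> dd_elems m n \<longleftrightarrow> 1 \<le> j \<and> j < n"
  by (auto simp: dd_elems_def)

lemma dd_init_eq:
  assumes "2 \<le> m" "2 \<le> n"
  shows "\<And>j. 1 \<le> j \<Longrightarrow> j \<le> m - 1 \<Longrightarrow> dd_init m n \<pi> (A j) = \<pi> j"
    and "dd_init m n \<pi> U = \<pi> m"
    and "dd_init m n \<pi> V = \<pi> (m + 1)"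
    and "\<And>j. 1 \<le> j \<Longrightarrow> j \<le> n - 1 \<Longrightarrow> dd_init m n \<pi> (B j) = \<pi> (m + 1 + j)"
proof -
  fix j assume "1 \<le> j" "j \<le> m - 1"
  then have "m + n + 1 - (n + 1 + (m - j)) = j" by linarith
  then show "dd_init m n \<pi> (A j) = \<pi> j" by (simp only: dd_init_def dd_sigma.simps)
next
  fix j assume "1 \<le> j" "j \<le> n - 1"
  then have "m + n + 1 - (n - j) = m + 1 + j" by linarith
  then show "dd_init m n \<pi> (B j) = \<pi> (m + 1 + j)" by (simp only: dd_init_def dd_sigma.simps)
next
  have "m + n + 1 - (n + 1) = m" "m + n + 1 - n = m + 1" by linarith+
  then show "dd_init m n \<pi> U = \<pi> m" "dd_init m n \<pi> V = \<pi> (m + 1)"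
    by (simp_all only: dd_init_def dd_sigma.simps)
qed

lemma card_dd_elems:
  assumes "2 \<le> m" "2 \<le> n"
  shows "card (dd_elems m n) = m + n"
proof -
  have "card (A ` {1..m - 1}) = m - 1" "card (B ` {1..n - 1}) = n - 1"
    by (subst card_image; simp add: inj_on_def)+
  moreover have "card (A ` {1..m - 1} \<union> {U, V} \<union> B ` {1..n - 1})
      = card (A ` {1..m - 1}) + card {U, V} + card (B ` {1..n - 1})"
    by (subst card_Un_disjoint, force, force, force)+ simp
  ultimately show ?thesis using assms by (simp add: dd_elems_def)
qed

text \<open>The explicit order relation on \<open>D\<^sub>m\<^sub>,\<^sub>n\<close>: \<open>x < y\<close> iff \<open>T1\<close> is larger at \<open>x\<close>, except that
  \<open>U\<close> and \<open>V\<close> are incomparable.\<close>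

lemma trancl_dd_cover:
  assumes "2 \<le> m" "2 \<le> n"
  shows "((dd_cover m n)\<inverse>)\<^sup>+ =
    {(x, y). x \<in> dd_elems m n \<and> y \<in> dd_elems m n \<and> T1 m y < T1 m x \<and> {x, y} \<noteq> {U, V}}"
    (is "?L = ?R")
proof
  have base: "(x, y) \<in> ?R" if "(x, y) \<in> (dd_cover m n)\<inverse>" for x y
    using that assms by (auto simp: dd_cover_def doubleton_eq_iff)
  have tr: "(x, z) \<in> ?R" if "(x, y) \<in> ?R" "(y, z) \<in> ?R" for x y z
    using that by (auto simp: doubleton_eq_iff)
  show "?L \<subseteq> ?R"
  proof clarify
    fix x y assume "(x, y) \<in> ?L"
    then have "(x, y) \<in> ?R"
    proof induction
      case (base y)
      then show ?case by (rule \<open>\<And>x y. (x, y) \<in> (dd_cover m n)\<inverse> \<Longrightarrow> (x, y) \<in> ?R\<close>)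
    next
      case (step y z)
      show ?case by (rule tr[OF step.IH base[OF step.hyps(2)]])
    qed
    then show "x \<in> dd_elems m n \<and> y \<in> dd_elems m n \<and> T1 m y < T1 m x \<and> {x, y} \<noteq> {U, V}"
      by blast
  qed
  let ?C = "((dd_cover m n)\<inverse>)"
  have aa: "(A (i + Suc k), A i) \<in> ?C\<^sup>+" if "1 \<le> i" "i + Suc k \<le> m - 1" for i k
    using that
  proof (induction k)
    case 0
    then show ?case by (intro r_into_trancl) (auto simp: dd_cover_def)
  next
    case (Suc k)
    have "(A (i + Suc (Suc k)), A (i + Suc k)) \<in> ?C"
      using Suc.prems by (auto simp: dd_cover_def)
    with Suc show ?case by (intro trancl_into_trancl2[OF _ Suc.IH]) auto
  qed
  have bb: "(B (i + Suc k), B i) \<in> ?C\<^sup>+" if "1 \<le> i" "i + Suc k \<le> n - 1" for i k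
    using that
  proof (induction k)
    case 0
    then show ?case by (intro r_into_trancl) (auto simp: dd_cover_def)
  next
    case (Suc k)
    have "(B (i + Suc (Suc k)), B (i + Suc k)) \<in> ?C"
      using Suc.prems by (auto simp: dd_cover_def)
    with Suc show ?case by (intro trancl_into_trancl2[OF _ Suc.IH]) auto
  qed
  have AA: "(A j, A i) \<in> ?C\<^sup>+" if "1 \<le> i" "i < j" "j \<le> m - 1" for i j
    using aa[of i "j - i - 1"] that by simp
  have BB: "(B j, B i) \<in> ?C\<^sup>+" if "1 \<le> i" "i < j" "j \<le> n - 1" for i j
    using bb[of i "j - i - 1"] that by simp
  have UA: "(w, A i) \<in> ?C\<^sup>+" if "1 \<le> i" "i \<le> m - 1" "w = U \<or> w = V" for i w
  proof -
    have 1: "(w, A (m - 1)) \<in> ?C\<^sup>+" using that by (intro r_into_trancl) (auto simp: dd_cover_def)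
    show ?thesis
      using 1 AA[of i "m - 1"] that by (cases "i = m - 1") (auto intro: trancl_trans)
  qed
  have BU: "(B i, w) \<in> ?C\<^sup>+" if "1 \<le> i" "i \<le> n - 1" "w = U \<or> w = V" for i w
  proof -
    have 1: "(B 1, w) \<in> ?C\<^sup>+" using that by (intro r_into_trancl) (auto simp: dd_cover_def)
    show ?thesis
      using 1 BB[of 1 i] that by (cases "i = 1") (auto intro: trancl_trans)
  qed
  have BA: "(B j, A i) \<in> ?C\<^sup>+" if "1 \<le> i" "i \<le> m - 1" "1 \<le> j" "j \<le> n - 1" for i j
    using BU[of j U] UA[of i U] that by (auto intro: trancl_trans)
  show "?R \<subseteq> ?L"
  proof clarify
    fix x y assume "x \<in> dd_elems m n" "y \<in> dd_elems m n" "T1 m y < T1 m x" "{x, y} \<noteq> {U, V}"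
    then show "(x, y) \<in> ?L"
      by (cases x; cases y) (auto simp: doubleton_eq_iff intro: AA BB UA BU BA)
  qed
qed

lemma dd_order_eq:
  assumes "2 \<le> m" "2 \<le> n"
  shows "dd_order m n = {(x, y). x \<in> dd_elems m n \<and> y \<in> dd_elems m n \<and>
    (x = y \<or> (T1 m y < T1 m x \<and> {x, y} \<noteq> {U, V}))}"
  unfolding dd_order_def trancl_dd_cover[OF assms] by auto

lemma partial_order_dd_order:
  assumes "2 \<le> m" "2 \<le> n"
  shows "partial_order_on (dd_elems m n) (dd_order m n)"
proof -
  have "trans (dd_order m n)"
    unfolding dd_order_def trans_def by (auto intro: trancl_trans)
  then show ?thesis
    unfolding partial_order_on_def preorder_on_def refl_on_def antisym_def
    by (auto simp: dd_order_eq[OF assms])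
qed

lemma covered_by_dd_order:
  assumes "2 \<le> m" "2 \<le> n"
  shows "y \<in> covered_by (dd_order m n) x \<longleftrightarrow> (x, y) \<in> dd_cover m n"
proof
  let ?r = "dd_order m n"
  assume c: "y \<in> covered_by ?r x"
  have "(y, x) \<in> ((dd_cover m n)\<inverse>)\<^sup>+"
    using c by (auto simp: covered_by_def dd_order_def)
  then obtain z where z: "(y, z) \<in> (dd_cover m n)\<inverse>" "(z, x) \<in> ((dd_cover m n)\<inverse>)\<^sup>*"
    by (meson tranclD)
  have yz: "(y, z) \<in> ((dd_cover m n)\<inverse>)\<^sup>+" using z(1) by blast
  then have "y \<noteq> z" unfolding trancl_dd_cover[OF assms] by auto
  moreover have "(y, z) \<in> ?r" using yz by (simp add: dd_order_def)
  moreover have "z = x \<or> (z, x) \<in> ?r"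
    using z(2) by (auto simp: dd_order_def rtrancl_eq_or_trancl)
  ultimately have "z = x" using c unfolding covered_by_def by auto
  then show "(x, y) \<in> dd_cover m n" using z(1) by simp
next
  let ?r = "dd_order m n"
  assume c: "(x, y) \<in> dd_cover m n"
  then have yx: "(y, x) \<in> ((dd_cover m n)\<inverse>)\<^sup>+" by blast
  have "y \<noteq> x" using yx unfolding trancl_dd_cover[OF assms] by auto
  moreover have "(y, x) \<in> ?r" using yx by (simp add: dd_order_def)
  moreover have False if "(y, z) \<in> ?r" "z \<noteq> y" "(z, x) \<in> ?r" "z \<noteq> x" for z
    using that c assms unfolding dd_order_eq[OF assms]
    by (cases z) (auto simp: dd_cover_def doubleton_eq_iff)
  ultimately show "y \<in> covered_by ?r x" unfolding covered_by_def by blast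
qed

lemma labelingI:
  assumes "2 \<le> m" "2 \<le> n" "inj_on L (dd_elems m n)" "L ` dd_elems m n \<subseteq> {1..m + n}"
  shows "labeling (dd_elems m n) L"
proof -
  have "card (L ` dd_elems m n) = m + n"
    using assms by (simp add: card_image card_dd_elems)
  then have "L ` dd_elems m n = {1..m + n}"
    using assms(4) by (intro card_subset_eq) auto
  then show ?thesis
    using assms by (simp add: labeling_def bij_betw_def card_dd_elems)
qed

lemma linear_extension_dd_sigma:
  assumes "2 \<le> m" "2 \<le> n"
  shows "linear_extension (dd_elems m n) (dd_order m n) (dd_sigma m n)"
proof -
  have "labeling (dd_elems m n) (dd_sigma m n)"
    using assms by (intro labelingI) (auto simp: inj_on_def dd_elems_def)
  moreover have "dd_sigma m n x < dd_sigma m n y"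
    if "(x, y) \<in> dd_order m n" "x \<noteq> y" for x y
    using that assms unfolding dd_order_eq[OF assms]
    by (cases x; cases y; simp add: doubleton_eq_iff; linarith?)
  ultimately show ?thesis by (auto simp: linear_extension_def)
qed

lemma dual_linear_extension_T1_T2:
  assumes "2 \<le> m" "2 \<le> n"
  shows "dual_linear_extension (dd_elems m n) (dd_order m n) (T1 m)"
    and "dual_linear_extension (dd_elems m n) (dd_order m n) (T2 m)"
proof -
  have "labeling (dd_elems m n) (T1 m)" "labeling (dd_elems m n) (T2 m)"
    using assms by (intro labelingI; auto simp: inj_on_def dd_elems_def)+
  moreover have "T1 m x > T1 m y \<and> T2 m x > T2 m y"
    if "(x, y) \<in> dd_order m n" "x \<noteq> y" for x y
    using that assms unfolding dd_order_eq[OF assms]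
    by (cases x; cases y; simp add: doubleton_eq_iff; linarith?)
  ultimately show
    "dual_linear_extension (dd_elems m n) (dd_order m n) (T1 m)"
    "dual_linear_extension (dd_elems m n) (dd_order m n) (T2 m)"
    by (auto simp: dual_linear_extension_def)
qed

end

theory Submission
  imports Defs "HOL-Combinatorics.Multiset_Permutations"
begin

text \<open>Reading \<open>\<pi>\<close> from the right, each round inserts a label into an ordered order ideal. In the
  round of \<open>\<pi>\<^sub>j\<close> with \<open>j \<le> m\<close>, whether the labels of \<open>u\<close> and \<open>v\<close> exchange their relative order
  depends only on the entry \<open>c\<^sub>j = #{i > j. \<pi>\<^sub>i < \<pi>\<^sub>j}\<close> of the Lehmer code: they do iff
  \<open>c\<^sub>j > m - j\<close>. Since \<open>c\<^sub>j\<close> ranges freely over \<open>{0..m + n - j}\<close>, the signed count factors as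
  \<open>n! (1 - n) (2 - n) \<dots> (m - n)\<close>.\<close>

section \<open>Sums over permutations of products over the Lehmer code\<close>

text \<open>Adjoining a new maximum leaves all ranks unchanged and has itself rank
  \<open>card S\<close>, so each rank occurs once.\<close>

lemma sum_card_less:
  fixes S :: "'a::linorder set"
  assumes "finite S"
  shows "(\<Sum>x\<in>S. f (card {y\<in>S. y < x})) = (\<Sum>c<card S. f c)"
  using assms
proof (induction S rule: finite_linorder_max_induct)
  case empty
  then show ?case by simp
next
  case (insert b S)
  have b: "b \<notin> S" using insert.hyps(2) by blast
  have "{y\<in>insert b S. y < x} = {y\<in>S. y < x}" if "x \<in> S" for x
    using insert.hyps(2) that by force
  moreover have "{y\<in>insert b S. y < b} = S" using insert.hyps(2) by auto
  ultimately show ?case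
    using insert b by (simp add: add.commute cong: sum.cong)
qed

text \<open>On a list without repetitions the second argument of \<open>w\<close> is the Lehmer code
  entry of \<open>x\<close>; the first is the largest value this entry can take.\<close>

fun lehmer_weight :: "(nat \<Rightarrow> nat \<Rightarrow> 'b::comm_semiring_1) \<Rightarrow> 'a::linorder list \<Rightarrow> 'b" where
  "lehmer_weight w [] = 1"
| "lehmer_weight w (x # xs) = w (length xs) (card {y\<in>set xs. y < x}) * lehmer_weight w xs"

text \<open>The first letter contributes a factor depending only on its rank in \<open>S\<close>,
  while the sum over the rest depends only on the number of remaining letters.\<close>

lemma sum_lehmer_weight:
  assumes "finite S"
  shows "(\<Sum>xs\<in>permutations_of_set S. lehmer_weight w xs) = (\<Prod>k<card S. \<Sum>c\<le>k. w k c)"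
  using assms
proof (induction "card S" arbitrary: S)
  case 0
  then show ?case by simp
next
  case (Suc k)
  have ne: "S \<noteq> {}" using Suc.hyps(2) by auto
  have "(\<Sum>xs\<in>permutations_of_set S. lehmer_weight w xs)
      = (\<Sum>x\<in>S. \<Sum>xs\<in>permutations_of_set (S - {x}). lehmer_weight w (x # xs))"
    unfolding permutations_of_set_nonempty[OF ne]
    by (subst sum.UNION_disjoint)
       (use Suc.prems in \<open>auto simp: sum.reindex inj_on_def\<close>)
  also have "\<dots> = (\<Sum>x\<in>S. w k (card {y\<in>S. y < x}) * (\<Prod>k<k. \<Sum>c\<le>k. w k c))"
  proof (rule sum.cong)
    fix x assume x: "x \<in> S"
    have k: "card (S - {x}) = k" using x Suc by simp
    have "lehmer_weight w (x # xs) = w k (card {y\<in>S. y < x}) * lehmer_weight w xs"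
      if "xs \<in> permutations_of_set (S - {x})" for xs
    proof -
      have "{y\<in>set xs. y < x} = {y\<in>S. y < x}"
        using permutations_of_setD(1)[OF that] by auto
      then show ?thesis using k that by (simp add: length_finite_permutations_of_set)
    qed
    then have "(\<Sum>xs\<in>permutations_of_set (S - {x}). lehmer_weight w (x # xs))
        = w k (card {y\<in>S. y < x}) * (\<Sum>xs\<in>permutations_of_set (S - {x}). lehmer_weight w xs)"
      by (simp add: sum_distrib_left)
    then show "(\<Sum>xs\<in>permutations_of_set (S - {x}). lehmer_weight w (x # xs))
        = w k (card {y\<in>S. y < x}) * (\<Prod>k<k. \<Sum>c\<le>k. w k c)"
      using Suc.hyps(1)[of "S - {x}"] k Suc.prems by simp
  qed simp
  also have "\<dots> = (\<Sum>c<card S. w k c) * (\<Prod>k<k. \<Sum>c\<le>k. w k c)"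
    by (simp add: sum_card_less[OF Suc.prems] flip: sum_distrib_right)
  also have "\<dots> = (\<Prod>k<card S. \<Sum>c\<le>k. w k c)"
    unfolding Suc.hyps(2)[symmetric] prod.lessThan_Suc by (simp only: lessThan_Suc_atMost mult.commute)
  finally show ?case .
qed

lemma bij_betw_permutes_permutations_of_set:
  "bij_betw (\<lambda>\<pi>. map \<pi> [1..<Suc N]) {\<pi>. \<pi> permutes {1..N}} (permutations_of_set {1..N})"
proof -
  let ?f = "\<lambda>\<pi>::nat \<Rightarrow> nat. map \<pi> [1..<Suc N]"
  have set: "set [1..<Suc N] = {1..N}" by auto
  have inj: "inj_on ?f {\<pi>. \<pi> permutes {1..N}}"
  proof (rule inj_onI)
    fix p q assume pq: "p \<in> {\<pi>. \<pi> permutes {1..N}}" "q \<in> {\<pi>. \<pi> permutes {1..N}}" "?f p = ?f q"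
    then have "p x = q x" if "x \<in> {1..N}" for x using that set by (auto simp: map_eq_conv simp del: upt_Suc)
    then show "p = q" using pq by (intro ext) (metis mem_Collect_eq permutes_not_in)
  qed
  have sub: "?f ` {\<pi>. \<pi> permutes {1..N}} \<subseteq> permutations_of_set {1..N}"
  proof clarify
    fix p :: "nat \<Rightarrow> nat" assume p: "p permutes {1..N}"
    have "set (?f p) = {1..N}" using permutes_image[OF p] set by (simp only: set_map)
    moreover have "distinct (?f p)"
      using permutes_inj_on[OF p] by (simp only: distinct_map distinct_upt simp_thms)
    ultimately show "?f p \<in> permutations_of_set {1..N}" by (intro permutations_of_setI)
  qed
  have "card (?f ` {\<pi>. \<pi> permutes {1..N}}) = card (permutations_of_set {1..N})"
    using inj by (simp add: card_image card_permutations del: upt_Suc)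
  then have "?f ` {\<pi>. \<pi> permutes {1..N}} = permutations_of_set {1..N}"
    using sub by (intro card_subset_eq) auto
  then show ?thesis using inj by (simp only: bij_betw_def)
qed

section \<open>One round of jeu de taquin\<close>

text \<open>The labels increase along all covers except possibly those below the moving label at \<open>x\<close>,
  and the elements above \<open>x\<close> are already compatible with the label that moves up to \<open>x\<close> next.\<close>

definition jdt_inv :: "('a \<times> 'a) set \<Rightarrow> 'a set \<Rightarrow> ('a \<Rightarrow> nat) \<Rightarrow> 'a \<Rightarrow> ('a \<Rightarrow> nat) \<Rightarrow> bool" where
  "jdt_inv r S L\<^sub>0 x L \<longleftrightarrow>
     x \<in> S \<and> inj_on L S \<and> L ` S = L\<^sub>0 ` S \<and> (\<forall>z. z \<notin> S \<longrightarrow> L z = L\<^sub>0 z) \<and>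
     (\<forall>p\<in>S. \<forall>q\<in>covered_by r p. p \<noteq> x \<longrightarrow> L p < L q) \<and>
     (\<forall>p\<in>S. \<forall>q\<in>covered_by r x. x \<in> covered_by r p \<longrightarrow> L p < L q)"

text \<open>The label \<open>L y\<close> that rises to \<open>x\<close> exceeds the labels of the
  elements covering \<open>x\<close> by the last clause of \<open>jdt_inv\<close>, and it is the
  least label covered by \<open>x\<close>. The rank \<open>s\<close> rules out coincidences among
  the elements involved.\<close>

lemma jdt_inv_step:
  fixes s :: "'a \<Rightarrow> nat"
  assumes closed: "\<And>p. p \<in> S \<Longrightarrow> covered_by r p \<subseteq> S"
    and rank: "\<And>p q. p \<in> S \<Longrightarrow> q \<in> covered_by r p \<Longrightarrow> s q < s p"
    and inv: "jdt_inv r S L\<^sub>0 x L"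
    and y: "y \<in> covered_by r x" "L y < L x" "\<And>q. q \<in> covered_by r x \<Longrightarrow> L y \<le> L q"
  shows "jdt_inv r S L\<^sub>0 y (L(x := L y, y := L x))"
proof -
  let ?L = "L(x := L y, y := L x)"
  note i = inv[unfolded jdt_inv_def]
  have xS: "x \<in> S" using i by blast
  have yS: "y \<in> S" using closed[OF xS] y by blast
  have xy: "x \<noteq> y" using y by auto
  \<comment> \<open>As a composition with a transposition of \<open>S\<close>, the swap preserves
    injectivity and image.\<close>
  have L': "?L = L \<circ> Transposition.transpose x y"
    using xy by (auto simp: fun_eq_iff Transposition.transpose_def)
  have perm: "Transposition.transpose x y permutes S"
    using xS yS by (rule permutes_swap_id)
  have inj: "inj_on L S" using i by blast
  have "inj_on ?L S"
    unfolding L' using inj permutes_image[OF perm] permutes_inj_on[OF perm]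
    by (intro comp_inj_on) simp_all
  moreover have "?L ` S = L\<^sub>0 ` S"
    unfolding L' image_comp[symmetric] permutes_image[OF perm] using i by blast
  moreover have "\<forall>z. z \<notin> S \<longrightarrow> ?L z = L\<^sub>0 z" using i xS yS by auto
  moreover have "?L p < ?L q" if "p \<in> S" "q \<in> covered_by r p" "p \<noteq> y" for p q
  proof -
    have qS: "q \<in> S" using closed that by blast
    have "q \<noteq> p" using rank[OF that(1,2)] by auto
    show ?thesis
    proof (cases "p = x")
      case True
      then have "q = y \<or> L y < L q"
        using y(3)[of q] inj qS yS that(2) by (metis inj_onD nat_less_le)
      then show ?thesis using True xy y \<open>q \<noteq> p\<close> by auto
    next
      case False
      then have "L p < L q" using i that by blast
      moreover have "L p < L y" if "q = x"
        using i y(1) \<open>p \<in> S\<close> \<open>q \<in> covered_by r p\<close> that by blast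
      ultimately show ?thesis using that(3) False xy y(2) by auto
    qed
  qed
  moreover have "?L p < ?L q" if "p \<in> S" "y \<in> covered_by r p" "q \<in> covered_by r y" for p q
  proof -
    have "s q < s y" "s y < s x" "s y < s p" using rank that y xS yS by blast+
    then have ne: "q \<noteq> y" "q \<noteq> x" "p \<noteq> y" by auto
    have "L y < L q" using i yS that(3) xy by metis
    moreover have "L p < L y" if "p \<noteq> x" using i that \<open>p \<in> S\<close> \<open>y \<in> covered_by r p\<close> by blast
    ultimately show ?thesis using ne by (cases "p = x") auto
  qed
  ultimately show ?thesis unfolding jdt_inv_def using yS by blast
qed

text \<open>A loop rule for one round: \<open>s\<close> drops at every move and gives termination,
  and \<open>J\<close> is any further property that the moves preserve.\<close>

lemma jdt_round_induct:
  fixes s :: "'a \<Rightarrow> nat"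
  assumes fin: "finite S"
    and closed: "\<And>p. p \<in> S \<Longrightarrow> covered_by r p \<subseteq> S"
    and rank: "\<And>p q. p \<in> S \<Longrightarrow> q \<in> covered_by r p \<Longrightarrow> s q < s p"
    and x: "x \<in> S" "\<And>p. p \<in> S \<Longrightarrow> x \<notin> covered_by r p"
    and inj: "inj_on L\<^sub>0 S"
    and ord: "\<And>p q. p \<in> S \<Longrightarrow> p \<noteq> x \<Longrightarrow> q \<in> covered_by r p \<Longrightarrow> L\<^sub>0 p < L\<^sub>0 q"
    and base: "J x L\<^sub>0"
    and step: "\<And>z L y. jdt_inv r S L\<^sub>0 z L \<Longrightarrow> J z L \<Longrightarrow> y \<in> covered_by r z \<Longrightarrow> L y < L z \<Longrightarrow>
      (\<And>q. q \<in> covered_by r z \<Longrightarrow> L y \<le> L q) \<Longrightarrow> J y (L(z := L y, y := L z))"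
  obtains z where "jdt_inv r S L\<^sub>0 z (jdt_round r x L\<^sub>0)" "J z (jdt_round r x L\<^sub>0)"
    "\<And>q. q \<in> covered_by r z \<Longrightarrow> jdt_round r x L\<^sub>0 z < jdt_round r x L\<^sub>0 q"
proof -
  let ?b = "\<lambda>(x, L). \<not> (\<forall>y\<in>covered_by r x. L x < L y)"
  let ?c = "\<lambda>(x, L). let y = arg_min_on L (covered_by r x) in (y, L(x := L y, y := L x))"
  let ?P = "\<lambda>(z, L). jdt_inv r S L\<^sub>0 z L \<and> J z L"
  let ?Q = "\<lambda>(z, L). jdt_inv r S L\<^sub>0 z L \<and> J z L \<and> (\<forall>q\<in>covered_by r z. L z < L q)"
  have down: "\<exists>y. ?c (z, L) = (y, L(z := L y, y := L z)) \<and> y \<in> covered_by r z \<and> L y < L z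
      \<and> (\<forall>q\<in>covered_by r z. L y \<le> L q) \<and> z \<in> S"
    if P: "?P (z, L)" and b: "?b (z, L)" for z L
  proof -
    let ?y = "arg_min_on L (covered_by r z)"
    have z: "z \<in> S" and injL: "inj_on L S" using that by (auto simp: jdt_inv_def)
    have finz: "finite (covered_by r z)" using closed[OF z] fin by (rule finite_subset)
    obtain q where q: "q \<in> covered_by r z" "L q \<le> L z" using b by (auto simp: not_less)
    have y: "?y \<in> covered_by r z" using finz q by (intro arg_min_if_finite(1)) auto
    have le: "L ?y \<le> L q'" if "q' \<in> covered_by r z" for q'
      using q(1) that by (intro arg_min_least[OF finz]) auto
    \<comment> \<open>The loop guard only yields a covered label at most \<open>L z\<close>;
      injectivity makes the inequality strict.\<close>
    have "?y \<noteq> z" using rank[OF z y] by auto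
    then have "L ?y \<noteq> L z" using injL z closed[OF z] y by (meson inj_onD subsetD)
    then have "L ?y < L z" using le[OF q(1)] q(2) by linarith
    then show ?thesis using y le z by (auto simp: Let_def)
  qed
  have "?Q (while ?b ?c (x, L\<^sub>0))"
  proof (rule while_rule[where P = ?P and r = "measure (s \<circ> fst)"])
    show "?P (x, L\<^sub>0)" using x inj ord base by (auto simp: jdt_inv_def)
  next
    fix t assume t: "?P t" "?b t"
    obtain z L where zL: "t = (z, L)" by (cases t)
    obtain y where y: "?c (z, L) = (y, L(z := L y, y := L z))" "y \<in> covered_by r z" "L y < L z"
      "\<And>q. q \<in> covered_by r z \<Longrightarrow> L y \<le> L q" "z \<in> S"
      using down[OF t[unfolded zL]] by blast
    have J: "jdt_inv r S L\<^sub>0 z L" "J z L" using t zL by auto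
    have "jdt_inv r S L\<^sub>0 y (L(z := L y, y := L z))"
      by (rule jdt_inv_step[OF closed rank J(1) y(2-4)])
    moreover have "J y (L(z := L y, y := L z))" by (rule step[OF J y(2-4)])
    ultimately show "?P (?c t)" unfolding zL y(1) by blast
    show "(?c t, t) \<in> measure (s \<circ> fst)"
      unfolding zL y(1) using rank[OF y(5,2)] by simp
  next
    fix t assume t: "?P t" "\<not> ?b t"
    then show "?Q t" by (cases t) auto
  qed simp
  then obtain z where "jdt_inv r S L\<^sub>0 z (jdt_round r x L\<^sub>0)" "J z (jdt_round r x L\<^sub>0)"
    "\<forall>q\<in>covered_by r z. jdt_round r x L\<^sub>0 z < jdt_round r x L\<^sub>0 q"
    unfolding jdt_round_def by (cases "while ?b ?c (x, L\<^sub>0)") auto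
  then show ?thesis using that by blast
qed

section \<open>Jeu de taquin on the double-tailed diamond\<close>

text \<open>State of a round started above \<open>U\<close> and \<open>V\<close>, with moving label
  \<open>y\<close> at \<open>x\<close>. It moves onto whichever of \<open>U\<close>,
  \<open>V\<close> has the smaller old label; leaving that for \<open>B 1\<close> pulls up a label
  exceeding the untouched one, which reverses the comparison.\<close>

definition uv_inv :: "(dd \<Rightarrow> nat) \<Rightarrow> nat \<Rightarrow> dd \<Rightarrow> (dd \<Rightarrow> nat) \<Rightarrow> bool" where
  "uv_inv L\<^sub>0 y x L \<longleftrightarrow> L x = y \<and> (case x of
      A _ \<Rightarrow> L U = L\<^sub>0 U \<and> L V = L\<^sub>0 V
    | U \<Rightarrow> L V = L\<^sub>0 V \<and> L\<^sub>0 U < L\<^sub>0 V \<and> L\<^sub>0 U < y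
    | V \<Rightarrow> L U = L\<^sub>0 U \<and> L\<^sub>0 V < L\<^sub>0 U \<and> L\<^sub>0 V < y
    | B _ \<Rightarrow> L\<^sub>0 U < y \<and> L\<^sub>0 V < y \<and> (L U < L V \<longleftrightarrow> \<not> L\<^sub>0 U < L\<^sub>0 V))"

text \<open>In the round of \<open>U\<close> the moving label can only enter the lower tail. Then it
  exceeds the label of \<open>B 1\<close>, hence that of \<open>V\<close>, and so does the label
  risen to \<open>U\<close>.\<close>

definition u_inv :: "(dd \<Rightarrow> nat) \<Rightarrow> dd \<Rightarrow> (dd \<Rightarrow> nat) \<Rightarrow> bool" where
  "u_inv L\<^sub>0 x L \<longleftrightarrow> (case x of
      U \<Rightarrow> L U = L\<^sub>0 U \<and> L V = L\<^sub>0 V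
    | B _ \<Rightarrow> L\<^sub>0 V < L\<^sub>0 U \<and> L V < L U
    | _ \<Rightarrow> False)"

locale double_tailed =
  fixes m n :: nat
  assumes m: "2 \<le> m" and n: "2 \<le> n"
begin

abbreviation "P \<equiv> dd_elems m n"
abbreviation "r \<equiv> dd_order m n"
abbreviation "\<sigma> \<equiv> dd_sigma m n"

text \<open>The order ideal of the elements treated in the first \<open>i\<close> rounds.\<close>

definition S :: "nat \<Rightarrow> dd set" where
  "S i = {x\<in>P. \<sigma> x \<le> i}"

lemma covered: "y \<in> covered_by r x \<longleftrightarrow> (x, y) \<in> dd_cover m n"
  using covered_by_dd_order m n by blast

lemma cover_elems: "(x, y) \<in> dd_cover m n \<Longrightarrow> x \<in> P \<and> y \<in> P \<and> \<sigma> y < \<sigma> x"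
  using m n by (auto simp: dd_cover_def)

lemma S_closed: "p \<in> S i \<Longrightarrow> covered_by r p \<subseteq> S i"
  using cover_elems by (fastforce simp: S_def covered)

lemma bij_sigma: "bij_betw \<sigma> P {1..m + n}"
  using linear_extension_dd_sigma[OF m n] card_dd_elems[OF m n]
  by (simp add: linear_extension_def labeling_def)

lemma finite_P: "finite P" by (simp add: dd_elems_def)

lemma finite_S [simp]: "finite (S i)" by (simp add: S_def finite_P)

lemma S_Suc:
  assumes "x \<in> P" "\<sigma> x = Suc i"
  shows "S (Suc i) = insert x (S i)" "x \<notin> S i"
  using assms inj_onD[OF bij_betw_imp_inj_on[OF bij_sigma]] by (fastforce simp: S_def le_Suc_eq)+

lemma sigma_image_S: "i \<le> m + n \<Longrightarrow> \<sigma> ` S i = {1..i}"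
proof -
  assume i: "i \<le> m + n"
  have "\<sigma> ` S i = {t\<in>\<sigma> ` P. t \<le> i}" by (auto simp: S_def)
  also have "\<dots> = {1..i}" using bij_sigma i by (auto simp: bij_betw_def)
  finally show ?thesis .
qed

lemma S_full: "S (m + n) = P"
  using bij_sigma by (fastforce simp: S_def bij_betw_def)

definition ordered :: "dd set \<Rightarrow> (dd \<Rightarrow> nat) \<Rightarrow> bool" where
  "ordered X L \<longleftrightarrow> inj_on L X \<and> (\<forall>p\<in>X. \<forall>q\<in>covered_by r p. L p < L q)"

text \<open>The loop rule for round \<open>Suc i\<close>, whose element is maximal in
  \<open>S (Suc i)\<close>. The stopping condition supplies the inequalities below \<open>z\<close>
  that \<open>jdt_inv\<close> leaves open.\<close>

lemma round_induct:
  assumes x: "x \<in> P" "\<sigma> x = Suc i" and L\<^sub>0: "ordered (S i) L\<^sub>0" "inj_on L\<^sub>0 (S (Suc i))"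
    and base: "J x L\<^sub>0"
    and step: "\<And>z L y. jdt_inv r (S (Suc i)) L\<^sub>0 z L \<Longrightarrow> J z L \<Longrightarrow> (z, y) \<in> dd_cover m n \<Longrightarrow>
      L y < L z \<Longrightarrow> (\<And>q. (z, q) \<in> dd_cover m n \<Longrightarrow> L y \<le> L q) \<Longrightarrow> J y (L(z := L y, y := L z))"
  obtains z L where "L = jdt_round r x L\<^sub>0" "ordered (S (Suc i)) L" "L ` S (Suc i) = L\<^sub>0 ` S (Suc i)"
    "\<And>p. p \<notin> S (Suc i) \<Longrightarrow> L p = L\<^sub>0 p" "z \<in> S (Suc i)" "J z L"
proof -
  note S = S_Suc[OF x]
  have rank: "\<And>p q. p \<in> S (Suc i) \<Longrightarrow> q \<in> covered_by r p \<Longrightarrow> \<sigma> q < \<sigma> p"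
    using cover_elems covered by blast
  have ord: "\<And>p q. p \<in> S (Suc i) \<Longrightarrow> p \<noteq> x \<Longrightarrow> q \<in> covered_by r p \<Longrightarrow> L\<^sub>0 p < L\<^sub>0 q"
    using L\<^sub>0(1) S by (auto simp: ordered_def)
  have max: "x \<notin> covered_by r p" if "p \<in> S (Suc i)" for p
    using rank[OF that, of x] that x by (auto simp: S_def)
  obtain z where z: "jdt_inv r (S (Suc i)) L\<^sub>0 z (jdt_round r x L\<^sub>0)" "J z (jdt_round r x L\<^sub>0)"
    "\<And>q. q \<in> covered_by r z \<Longrightarrow> jdt_round r x L\<^sub>0 z < jdt_round r x L\<^sub>0 q"
    by (rule jdt_round_induct[where S = "S (Suc i)" and s = \<sigma> and J = J,
          OF finite_S S_closed rank _ max L\<^sub>0(2) ord base])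
       (use S step in \<open>auto simp: covered\<close>)
  show ?thesis
    by (rule that[of "jdt_round r x L\<^sub>0" z]) (use z in \<open>auto simp: jdt_inv_def ordered_def\<close>)
qed

text \<open>By \<open>trancl_dd_cover\<close> the conditions on \<open>T1\<close> say that
  \<open>y\<close> lies below \<open>x\<close>. A chain of covers descending from \<open>x\<close>
  stays in the closed set \<open>X\<close>, and labels increase along it.\<close>

lemma ordered_trancl:
  assumes "ordered X L" "\<And>p. p \<in> X \<Longrightarrow> covered_by r p \<subseteq> X" "x \<in> X" "y \<in> P" "x \<in> P"
    "T1 m x < T1 m y" "{x, y} \<noteq> {U, V}"
  shows "L x < L y"
proof -
  have "(y, x) \<in> ((dd_cover m n)\<inverse>)\<^sup>+"
    unfolding trancl_dd_cover[OF m n] using assms by auto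
  then have "(x, y) \<in> (dd_cover m n)\<^sup>+" by (simp add: trancl_converse)
  then have "L x < L y \<and> y \<in> X"
  proof induction
    case (base y)
    then have "y \<in> covered_by r x" by (simp add: covered)
    then show ?case using assms(1-3) unfolding ordered_def by blast
  next
    case (step y z)
    then have "z \<in> covered_by r y" "y \<in> X" by (simp_all add: covered)
    then have "L y < L z" "z \<in> X" using assms(1,2) unfolding ordered_def by blast+
    then show ?case using step.IH by simp
  qed
  then show ?thesis ..
qed

lemma ordered_S_less:
  assumes "ordered (S i) L" "x \<in> S i" "y \<in> P" "T1 m x < T1 m y" "{x, y} \<noteq> {U, V}"
  shows "L x < L y"
  by (rule ordered_trancl[OF assms(1) S_closed]) (use assms in \<open>auto simp: S_def\<close>)

section \<open>Effect of one round on the comparison of \<open>U\<close> and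
  \<open>V\<close>\<close>

text \<open>The comparison is reversed iff both old labels lie below the new one. In
  \<open>S i\<close> the \<open>m - j - 1\<close> elements \<open>A k\<close> carry the smallest
  labels, then come \<open>U\<close> and \<open>V\<close>, then the \<open>B k\<close>; so this
  happens iff more than \<open>m - j = i - n\<close> labels are smaller.\<close>

lemma round_A:
  assumes j: "1 \<le> j" "j < m" and i: "i = n + (m - j)"
    and L\<^sub>0: "ordered (S i) L\<^sub>0" "inj_on L\<^sub>0 (S (Suc i))"
  obtains L where "L = jdt_round r (A j) L\<^sub>0" "ordered (S (Suc i)) L"
    "L ` S (Suc i) = L\<^sub>0 ` S (Suc i)" "\<And>p. p \<notin> S (Suc i) \<Longrightarrow> L p = L\<^sub>0 p"
    "L U < L V \<longleftrightarrow>
      (if i - n < card {z\<in>S i. L\<^sub>0 z < L\<^sub>0 (A j)} then \<not> L\<^sub>0 U < L\<^sub>0 V else L\<^sub>0 U < L\<^sub>0 V)"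
proof -
  let ?y = "L\<^sub>0 (A j)"
  have x: "A j \<in> P" "\<sigma> (A j) = Suc i" using j i by auto
  note Sx = S_Suc[OF x]
  have UV: "U \<in> S i" "V \<in> S i" using j i by (auto simp: S_def)
  have UVA: "U \<in> S (Suc i)" "V \<in> S (Suc i)" "A j \<in> S (Suc i)" using UV Sx by auto
  have neq: "L\<^sub>0 U \<noteq> L\<^sub>0 V" "L\<^sub>0 U \<noteq> ?y" "L\<^sub>0 V \<noteq> ?y"
    using inj_on_eq_iff[OF L\<^sub>0(2)] UVA by auto
  obtain z L where L: "L = jdt_round r (A j) L\<^sub>0" "ordered (S (Suc i)) L"
    "L ` S (Suc i) = L\<^sub>0 ` S (Suc i)" "\<And>p. p \<notin> S (Suc i) \<Longrightarrow> L p = L\<^sub>0 p"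
    and z: "z \<in> S (Suc i)" "uv_inv L\<^sub>0 ?y z L"
  proof (rule round_induct[OF x L\<^sub>0, where J = "uv_inv L\<^sub>0 ?y"])
    show "uv_inv L\<^sub>0 ?y (A j) L\<^sub>0" by (simp add: uv_inv_def)
  next
    fix z L y
    assume inv: "jdt_inv r (S (Suc i)) L\<^sub>0 z L" and J: "uv_inv L\<^sub>0 ?y z L"
      and y: "(z, y) \<in> dd_cover m n" "L y < L z" "\<And>q. (z, q) \<in> dd_cover m n \<Longrightarrow> L y \<le> L q"
    \<comment> \<open>While the moving label is at one of \<open>U\<close>, \<open>V\<close>, the
      invariant still orders the other against \<open>B 1\<close>.\<close>
    have V: "L V < L (B 1)" if "z = U"
      using inv that UVA by (auto simp: jdt_inv_def covered dd_cover_def)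
    have U: "L U < L (B 1)" if "z = V"
      using inv that UVA by (auto simp: jdt_inv_def covered dd_cover_def)
    have A: "L y \<le> L U" "L y \<le> L V" if "z = A (m - 1)"
      using y(3)[of U] y(3)[of V] that by (auto simp: dd_cover_def)
    consider i where "z = A i" "y = A (i + 1)" | "z = A (m - 1)" "y = U" | "z = A (m - 1)" "y = V"
      | "z = U" "y = B 1" | "z = V" "y = B 1" | i where "z = B i" "y = B (i + 1)"
      using y(1) by (auto simp: dd_cover_def)
    then show "uv_inv L\<^sub>0 ?y y (L(z := L y, y := L z))"
      by cases (use J y(2) U V A neq in \<open>auto simp: uv_inv_def\<close>)
  qed auto
  have bit: "L U < L V \<longleftrightarrow> (if L\<^sub>0 U < ?y \<and> L\<^sub>0 V < ?y then \<not> L\<^sub>0 U < L\<^sub>0 V else L\<^sub>0 U < L\<^sub>0 V)"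
  proof (cases z)
    case (A k)
    \<comment> \<open>A label stopping in the upper tail is below the unchanged label of
      \<open>U\<close>, so no reversal is due.\<close>
    have "L (A k) < L U"
      by (rule ordered_S_less[OF L(2)]) (use z(1) A in \<open>auto simp: S_def\<close>)
    then show ?thesis using z(2) A by (auto simp: uv_inv_def)
  qed (use z(2) neq in \<open>auto simp: uv_inv_def\<close>)
  have less: "L\<^sub>0 (A k) < L\<^sub>0 w" if "k \<in> {j<..<m}" "w = U \<or> w = V" for k w
    by (rule ordered_S_less[OF L\<^sub>0(1)]) (use that i in \<open>auto simp: S_def\<close>)
  have S_cases: "w \<in> A ` {j<..<m} \<or> w \<in> {U, V} \<or> (\<exists>k. w = B k \<and> w \<in> S i)" if "w \<in> S i" for w
    using that i by (cases w) (auto simp: S_def)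
  have less_B: "L\<^sub>0 w < L\<^sub>0 (B k)" if "B k \<in> S i" "w = U \<or> w = V" for k w
    by (rule ordered_S_less[OF L\<^sub>0(1)]) (use that UV in \<open>auto simp: S_def\<close>)
  have c: "card (A ` {j<..<m}) = m - j - 1"
    by (subst card_image) (auto simp: inj_on_def)
  have "i - n < card {z\<in>S i. L\<^sub>0 z < ?y} \<longleftrightarrow> L\<^sub>0 U < ?y \<and> L\<^sub>0 V < ?y"
  proof
    assume *: "L\<^sub>0 U < ?y \<and> L\<^sub>0 V < ?y"
    have "A ` {j<..<m} \<union> {U, V} \<subseteq> {z\<in>S i. L\<^sub>0 z < ?y}"
      using * UV less[of _ U] i by (fastforce simp: S_def)
    then have "card (A ` {j<..<m} \<union> {U, V}) \<le> card {z\<in>S i. L\<^sub>0 z < ?y}"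
      by (intro card_mono) auto
    moreover have "card (A ` {j<..<m} \<union> {U, V}) = m - j - 1 + 2"
      by (subst card_Un_disjoint) (auto simp: c)
    ultimately show "i - n < card {z\<in>S i. L\<^sub>0 z < ?y}" using i j by simp
  next
    assume *: "i - n < card {z\<in>S i. L\<^sub>0 z < ?y}"
    show "L\<^sub>0 U < ?y \<and> L\<^sub>0 V < ?y"
    proof (rule ccontr)
      assume "\<not> ?thesis"
      then have "?y < L\<^sub>0 U \<or> ?y < L\<^sub>0 V" using neq by linarith
      \<comment> \<open>\<open>w\<close> is one of \<open>U\<close>, \<open>V\<close> with a label
        above the new one. Every \<open>B k\<close> then has a larger label too, so at most
        \<open>w'\<close> joins the \<open>A k\<close> in the count.\<close>
      then obtain w w' where w: "?y < L\<^sub>0 w" "{w, w'} = {U, V}" by blast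
      have "w = U \<or> w = V" using w(2) by (auto simp: doubleton_eq_iff)
      then have "\<not> L\<^sub>0 (B k) < ?y" if "B k \<in> S i" for k
        using less_B[OF that, of w] w(1) by linarith
      then have "{z\<in>S i. L\<^sub>0 z < ?y} \<subseteq> A ` {j<..<m} \<union> {w'}"
        using S_cases w by (fastforce simp: doubleton_eq_iff)
      then have "card {z\<in>S i. L\<^sub>0 z < ?y} \<le> card (A ` {j<..<m} \<union> {w'})"
        by (intro card_mono) auto
      also have "\<dots> \<le> m - j - 1 + 1"
        using card_Un_le[of "A ` {j<..<m}" "{w'}"] c by simp
      finally show False using * i j by simp
    qed
  qed
  with bit have "L U < L V \<longleftrightarrow>
      (if i - n < card {z\<in>S i. L\<^sub>0 z < ?y} then \<not> L\<^sub>0 U < L\<^sub>0 V else L\<^sub>0 U < L\<^sub>0 V)" by simp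
  then show ?thesis using that[OF L] by blast
qed

text \<open>\<open>V\<close> has the least label of \<open>S n\<close>, so the new label exceeds
  some label there iff it exceeds that of \<open>V\<close>. The round preserves the comparison of
  \<open>U\<close> and \<open>V\<close>.\<close>

lemma round_U:
  assumes L\<^sub>0: "ordered (S n) L\<^sub>0" "inj_on L\<^sub>0 (S (Suc n))"
  obtains L where "L = jdt_round r U L\<^sub>0" "ordered (S (Suc n)) L"
    "L ` S (Suc n) = L\<^sub>0 ` S (Suc n)" "\<And>p. p \<notin> S (Suc n) \<Longrightarrow> L p = L\<^sub>0 p"
    "L U < L V \<longleftrightarrow> \<not> 0 < card {z\<in>S n. L\<^sub>0 z < L\<^sub>0 U}"
proof -
  have x: "U \<in> P" "\<sigma> U = Suc n" by auto
  note Sx = S_Suc[OF x]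
  have V: "V \<in> S n" by (auto simp: S_def)
  have UV: "U \<in> S (Suc n)" "V \<in> S (Suc n)" using V Sx by auto
  have neq: "L\<^sub>0 U \<noteq> L\<^sub>0 V" using inj_on_eq_iff[OF L\<^sub>0(2)] UV by auto
  obtain z L where L: "L = jdt_round r U L\<^sub>0" "ordered (S (Suc n)) L"
    "L ` S (Suc n) = L\<^sub>0 ` S (Suc n)" "\<And>p. p \<notin> S (Suc n) \<Longrightarrow> L p = L\<^sub>0 p"
    and z: "z \<in> S (Suc n)" "u_inv L\<^sub>0 z L"
  proof (rule round_induct[OF x L\<^sub>0, where J = "u_inv L\<^sub>0"])
    show "u_inv L\<^sub>0 U L\<^sub>0" by (simp add: u_inv_def)
  next
    fix z L y
    assume inv: "jdt_inv r (S (Suc n)) L\<^sub>0 z L" and J: "u_inv L\<^sub>0 z L"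
      and y: "(z, y) \<in> dd_cover m n" "L y < L z"
    have V: "L V < L (B 1)" if "z = U"
      using inv that UV by (auto simp: jdt_inv_def covered dd_cover_def)
    consider "z = U" "y = B 1" | i where "z = B i" "y = B (i + 1)"
      using y(1) J by (auto simp: dd_cover_def u_inv_def)
    then show "u_inv L\<^sub>0 y (L(z := L y, y := L z))"
      by cases (use J y(2) V in \<open>auto simp: u_inv_def\<close>)
  qed auto
  have bit: "L U < L V \<longleftrightarrow> \<not> L\<^sub>0 V < L\<^sub>0 U"
    using z(2) neq by (cases z) (auto simp: u_inv_def)
  have min: "L\<^sub>0 V < L\<^sub>0 w" if "w \<in> S n" "w \<noteq> V" for w
    by (rule ordered_S_less[OF L\<^sub>0(1) V]) (use that in \<open>cases w; auto simp: S_def doubleton_eq_iff\<close>)+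
  have "{z\<in>S n. L\<^sub>0 z < L\<^sub>0 U} \<noteq> {} \<longleftrightarrow> L\<^sub>0 V < L\<^sub>0 U"
    using V min by (auto intro: less_trans)
  then show ?thesis using that[OF L] bit by (simp add: card_gt_0_iff)
qed

text \<open>Serves the rounds before \<open>U\<close> enters, where no comparison needs
  tracking.\<close>

lemma round_le_n:
  assumes x: "x \<in> P" "\<sigma> x = Suc i" and L\<^sub>0: "ordered (S i) L\<^sub>0" "inj_on L\<^sub>0 (S (Suc i))"
  obtains L where "L = jdt_round r x L\<^sub>0" "ordered (S (Suc i)) L"
    "L ` S (Suc i) = L\<^sub>0 ` S (Suc i)" "\<And>p. p \<notin> S (Suc i) \<Longrightarrow> L p = L\<^sub>0 p"
  by (rule round_induct[OF x L\<^sub>0, where J = "\<lambda>_ _. True"]) auto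

text \<open>The weight is the sign of the comparison of \<open>U\<close> and \<open>V\<close>: the round that inserts a label above
  \<open>k \<ge> n\<close> earlier ones reverses it iff more than \<open>k - n\<close> of these are smaller than the new label.
  The round of \<open>U\<close> itself (\<open>k = n\<close>) behaves as if it started with \<open>U\<close> labeled below \<open>V\<close>.\<close>

definition w :: "nat \<Rightarrow> nat \<Rightarrow> int" where
  "w k c = (if n \<le> k \<and> k - n < c then -1 else 1)"

lemma lehmer_weight_cases: "lehmer_weight w xs = 1 \<or> lehmer_weight w xs = -1"
  by (induction xs) (auto simp: w_def)

lemma lehmer_weight_short: "length xs \<le> n \<Longrightarrow> lehmer_weight w xs = 1"
  by (induction xs) (auto simp: w_def)

section \<open>All rounds together\<close>

lemma inv_into_sigma:
  assumes "i < m + n"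
  shows "inv_into P \<sigma> (Suc i) \<in> P" "\<sigma> (inv_into P \<sigma> (Suc i)) = Suc i"
proof -
  have "Suc i \<in> \<sigma> ` P" using assms bij_sigma by (auto simp: bij_betw_def)
  then show "inv_into P \<sigma> (Suc i) \<in> P" "\<sigma> (inv_into P \<sigma> (Suc i)) = Suc i"
    by (auto intro: inv_into_into f_inv_into_f)
qed

text \<open>Earlier rounds only permute the last \<open>i\<close> letters over \<open>S i\<close>,
  so the counts in \<open>round_A\<close> and \<open>round_U\<close> are Lehmer code entries. The
  sign clause needs \<open>n < i\<close> because \<open>U\<close> enters in round
  \<open>n + 1\<close>.\<close>

lemma jdt_prefix:
  fixes \<pi> :: "nat \<Rightarrow> nat"
  assumes \<pi>: "\<pi> permutes {1..m + n}" and "i \<le> m + n"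
  defines "L \<equiv> fold (\<lambda>i. jdt_round r (inv_into P \<sigma> i)) [1..<Suc i] (dd_init m n \<pi>)"
  shows "ordered (S i) L \<and> L ` S i = dd_init m n \<pi> ` S i \<and>
    (\<forall>p. p \<notin> S i \<longrightarrow> L p = dd_init m n \<pi> p) \<and>
    (n < i \<longrightarrow> (L U < L V \<longleftrightarrow> lehmer_weight w (map \<pi> [m + n + 1 - i..<m + n + 1]) = 1))"
  using assms(2) unfolding L_def
proof (induction i)
  case 0
  have "S 0 = {}" using m n by (auto simp: S_def dd_elems_def)
  then show ?case by (simp add: ordered_def)
next
  case (Suc i)
  let ?I = "dd_init m n \<pi>"
  define L where "L = fold (\<lambda>i. jdt_round r (inv_into P \<sigma> i)) [1..<Suc i] ?I"
  define x where "x = inv_into P \<sigma> (Suc i)"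
  define xs where "xs = map \<pi> [m + n + 1 - i..<m + n + 1]"
  have x: "x \<in> P" "\<sigma> x = Suc i" using inv_into_sigma Suc.prems by (auto simp: x_def)
  have unfold: "fold (\<lambda>i. jdt_round r (inv_into P \<sigma> i)) [1..<Suc (Suc i)] ?I = jdt_round r x L"
    by (simp add: L_def x_def)
  have IH: "ordered (S i) L" "L ` S i = ?I ` S i" "\<And>p. p \<notin> S i \<Longrightarrow> L p = ?I p"
    "n < i \<Longrightarrow> L U < L V \<longleftrightarrow> lehmer_weight w xs = 1"
    using Suc.IH Suc.prems unfolding L_def xs_def by auto
  note Sx = S_Suc[OF x]
  have "inj_on \<sigma> P" using bij_sigma by (simp add: bij_betw_def)
  have inj_I: "inj_on ?I P"
  proof (rule inj_onI)
    fix p q assume pq: "p \<in> P" "q \<in> P" "?I p = ?I q"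
    have "\<sigma> p \<in> {1..m + n}" "\<sigma> q \<in> {1..m + n}" using bij_sigma pq by (auto simp: bij_betw_def)
    moreover have "m + n + 1 - \<sigma> p = m + n + 1 - \<sigma> q"
      using pq(3) permutes_inj[OF \<pi>] by (simp add: dd_init_def inj_eq)
    ultimately have "\<sigma> p = \<sigma> q" by auto
    then show "p = q" using \<open>inj_on \<sigma> P\<close> pq by (simp add: inj_on_eq_iff)
  qed
  have sub: "S (Suc i) \<subseteq> P" by (auto simp: S_def)
  have Lx: "L x = ?I x" using IH(3) Sx by blast
  have im: "L ` S (Suc i) = ?I ` S (Suc i)" using Sx IH(2) Lx by simp
  have "?I x \<notin> ?I ` S i"
    using inj_on_image_mem_iff[OF inj_I x(1), of "S i"] Sx(2) by (auto simp: S_def)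
  then have inj: "inj_on L (S (Suc i))"
    using Sx IH(1,2) Lx by (simp add: ordered_def)
  \<comment> \<open>The elements of \<open>S i\<close> have \<open>\<sigma>\<close>-values
    \<open>1\<close>, ..., \<open>i\<close>, hence initially carry the last \<open>i\<close>
    letters.\<close>
  have set_xs: "set xs = L ` S i"
  proof -
    have "L ` S i = (\<lambda>t. \<pi> (m + n + 1 - t)) ` \<sigma> ` S i"
      by (simp add: IH(2) dd_init_def image_image)
    also have "\<dots> = \<pi> ` (\<lambda>t. m + n + 1 - t) ` {1..i}"
      using sigma_image_S[of i] Suc.prems by (simp add: image_image)
    also have "(\<lambda>t. m + n + 1 - t) ` {1..i} = {m + n + 1 - i..<m + n + 1}"
    proof
      show "{m + n + 1 - i..<m + n + 1} \<subseteq> (\<lambda>t. m + n + 1 - t) ` {1..i}"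
      proof
        fix t assume "t \<in> {m + n + 1 - i..<m + n + 1}"
        then show "t \<in> (\<lambda>t. m + n + 1 - t) ` {1..i}"
          using Suc.prems by (intro image_eqI[of _ _ "m + n + 1 - t"]) auto
      qed
    qed auto
    finally show ?thesis unfolding xs_def by (simp only: set_map set_upt)
  qed
  have len: "length xs = i" using Suc.prems by (simp add: xs_def del: upt_Suc)
  have "m + n + 1 - Suc i = m + n - i" "m + n + 1 - i = Suc (m + n - i)"
    using Suc.prems by linarith+
  then have "[m + n + 1 - Suc i..<m + n + 1] = (m + n - i) # [m + n + 1 - i..<m + n + 1]"
    using upt_conv_Cons[of "m + n - i" "m + n + 1"] by simp
  then have list: "map \<pi> [m + n + 1 - Suc i..<m + n + 1] = L x # xs"
    unfolding Lx xs_def by (simp add: dd_init_def x(2))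
  have "card {y\<in>set xs. y < L x} = card (L ` {z\<in>S i. L z < L x})"
    unfolding set_xs by (rule arg_cong[of _ _ card]) auto
  also have "\<dots> = card {z\<in>S i. L z < L x}"
    using IH(1) by (intro card_image) (auto simp: ordered_def inj_on_def)
  finally have weight: "lehmer_weight w (L x # xs) = w i (card {z\<in>S i. L z < L x}) * lehmer_weight w xs"
    by (simp add: len)
  obtain L' where L': "L' = jdt_round r x L" "ordered (S (Suc i)) L'"
    "L' ` S (Suc i) = L ` S (Suc i)" "\<And>p. p \<notin> S (Suc i) \<Longrightarrow> L' p = L p"
    and bit: "n < Suc i \<Longrightarrow> L' U < L' V \<longleftrightarrow> lehmer_weight w (L x # xs) = 1"
  proof -
    \<comment> \<open>These are the rounds of the \<open>B k\<close> and \<open>V\<close>, of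
      \<open>U\<close>, and of the upper tail.\<close>
    consider "i < n" | "i = n" | "n < i" by linarith
    then show thesis
    proof cases
      case 1
      show thesis by (rule round_le_n[OF x IH(1) inj]) (use 1 that in auto)
    next
      case 2
      then have [simp]: "x = U" using x by (cases x) auto
      have "lehmer_weight w xs = 1" using len 2 by (intro lehmer_weight_short) simp
      then have "\<not> 0 < card {z\<in>S n. L z < L U} \<longleftrightarrow> lehmer_weight w (L x # xs) = 1"
        unfolding weight using 2 by (auto simp: w_def card_gt_0_iff)
      then show thesis
        using 2 that round_U[of L] IH(1) inj by (metis \<open>x = U\<close>)
    next
      case 3
      then obtain j where j: "x = A j" "1 \<le> j" "j < m" "i = n + (m - j)"
        using x by (cases x) auto
      show thesis
      proof (rule round_A[OF j(2-4) IH(1) inj])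
        fix L' assume L': "L' = jdt_round r (A j) L" "ordered (S (Suc i)) L'"
          "L' ` S (Suc i) = L ` S (Suc i)" "\<And>p. p \<notin> S (Suc i) \<Longrightarrow> L' p = L p"
          and b: "L' U < L' V \<longleftrightarrow>
            (if i - n < card {z\<in>S i. L z < L (A j)} then \<not> L U < L V else L U < L V)"
        have "L' U < L' V \<longleftrightarrow> lehmer_weight w (L x # xs) = 1"
          unfolding b weight using IH(4)[OF 3] 3 lehmer_weight_cases[of xs]
          by (auto simp: w_def j(1))
        then show thesis using that[of L'] L' j(1) by simp
      qed
    qed
  qed
  show ?case
    unfolding unfold list L'(1)[symmetric] using L' bit im IH(3) Sx by auto
qed

section \<open>Identification of the output\<close>

text \<open>A bijective labeling is recovered from the order it induces: the label of
  \<open>x\<close> is the number of labels at most its own.\<close>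

lemma strict_mono_labelings_eq:
  assumes T: "bij_betw T P {1..m + n}" and L: "bij_betw L P {1..m + n}"
    and less: "\<And>x y. x \<in> P \<Longrightarrow> y \<in> P \<Longrightarrow> T x < T y \<Longrightarrow> L x < L y" and x: "x \<in> P"
  shows "L x = T x"
proof -
  have count: "card {y\<in>P. F y \<le> F x} = F x" if F: "bij_betw F P {1..m + n}" for F
  proof -
    have "F x \<le> m + n" using F x by (auto simp: bij_betw_def)
    then have "F ` {y\<in>P. F y \<le> F x} = {1..F x}"
      using F by (auto simp: bij_betw_def image_iff set_eq_iff) (metis atLeastAtMost_iff imageE le_trans)
    moreover have "inj_on F {y\<in>P. F y \<le> F x}"
      using F by (auto simp: bij_betw_def inj_on_def)
    ultimately show ?thesis using card_image by fastforce
  qed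
  have "T y \<le> T x \<longleftrightarrow> L y \<le> L x" if "y \<in> P" for y
    using less[OF x that] less[OF that x] inj_onD[OF bij_betw_imp_inj_on[OF T], of x y] x that
    by (cases "T x" "T y" rule: linorder_cases) auto
  then have "{y\<in>P. L y \<le> L x} = {y\<in>P. T y \<le> T x}" by auto
  then show ?thesis using count[OF T] count[OF L] by simp
qed

text \<open>The output is ordered on all of \<open>P\<close>, where only \<open>U\<close> and
  \<open>V\<close> are incomparable, so their comparison determines it; the weight records that
  comparison.\<close>

lemma dd_maps_to_iff:
  assumes \<pi>: "\<pi> permutes {1..m + n}"
  shows "dd_maps_to m n \<pi> (T1 m) \<longleftrightarrow> lehmer_weight w (map \<pi> [1..<Suc (m + n)]) = 1"
    and "dd_maps_to m n \<pi> (T2 m) \<longleftrightarrow> lehmer_weight w (map \<pi> [1..<Suc (m + n)]) = -1"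
proof -
  let ?L = "dd_jdt m n \<pi>" and ?W = "lehmer_weight w (map \<pi> [1..<Suc (m + n)])"
  have "?L = fold (\<lambda>i. jdt_round r (inv_into P \<sigma> i)) [1..<Suc (m + n)] (dd_init m n \<pi>)"
    by (simp only: dd_jdt_def jdt_def card_dd_elems[OF m n])
  then have ord: "ordered P ?L" and im: "?L ` P = dd_init m n \<pi> ` P"
    and bit: "?L U < ?L V \<longleftrightarrow> ?W = 1"
    using jdt_prefix[OF \<pi> order_refl] m n by (simp_all add: S_full del: upt_Suc)
  have "dd_init m n \<pi> ` P = \<pi> ` (\<lambda>t. m + n + 1 - t) ` \<sigma> ` P"
    by (simp add: dd_init_def image_image)
  also have "\<dots> \<subseteq> \<pi> ` {1..m + n}"
    using bij_sigma by (intro image_mono) (auto simp: bij_betw_def)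
  also have "\<dots> = {1..m + n}" by (rule permutes_image[OF \<pi>])
  finally have "labeling P ?L"
    using ord im m n by (intro labelingI) (auto simp: ordered_def)
  then have bij: "bij_betw ?L P {1..m + n}" by (simp add: labeling_def card_dd_elems[OF m n])
  have bijT: "bij_betw (T1 m) P {1..m + n}" "bij_betw (T2 m) P {1..m + n}"
    using dual_linear_extension_T1_T2[OF m n]
    by (auto simp: dual_linear_extension_def labeling_def card_dd_elems[OF m n])
  have closed: "covered_by r p \<subseteq> P" for p using cover_elems covered by blast
  have less: "?L x < ?L y" if "x \<in> P" "y \<in> P" "T1 m x < T1 m y" "{x, y} \<noteq> {U, V}" for x y
    using ordered_trancl[OF ord closed] that by blast
  have neq: "?L U \<noteq> ?L V" using inj_on_eq_iff[OF bij_betw_imp_inj_on[OF bij], of U V] by simp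
  have T1: "dd_maps_to m n \<pi> (T1 m)" if "?L U < ?L V"
    unfolding dd_maps_to_def
  proof
    fix x assume "x \<in> P"
    show "?L x = T1 m x"
    proof (rule strict_mono_labelings_eq[OF bijT(1) bij _ \<open>x \<in> P\<close>])
      fix x y assume "x \<in> P" "y \<in> P" "T1 m x < T1 m y"
      then show "?L x < ?L y"
        using less[of x y] that by (cases "{x, y} = {U, V}") (auto simp: doubleton_eq_iff)
    qed
  qed
  have T2: "dd_maps_to m n \<pi> (T2 m)" if "\<not> ?L U < ?L V"
    unfolding dd_maps_to_def
  proof
    fix x assume "x \<in> P"
    show "?L x = T2 m x"
    proof (rule strict_mono_labelings_eq[OF bijT(2) bij _ \<open>x \<in> P\<close>])
      fix x y assume xy: "x \<in> P" "y \<in> P" "T2 m x < T2 m y"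
      show "?L x < ?L y"
      proof (cases "{x, y} = {U, V}")
        case True
        then show ?thesis using xy(3) that neq by (auto simp: doubleton_eq_iff)
      next
        case False
        \<comment> \<open>\<open>T1\<close> and \<open>T2\<close> order all pairs alike except
          \<open>U\<close>, \<open>V\<close>.\<close>
        moreover have "T1 m x < T1 m y"
          using xy False by (cases x; cases y) auto
        ultimately show ?thesis using less xy by blast
      qed
    qed
  qed
  have "?L U < ?L V" if "dd_maps_to m n \<pi> (T1 m)" using that by (simp add: dd_maps_to_def)
  with T1 bit show "dd_maps_to m n \<pi> (T1 m) \<longleftrightarrow> ?W = 1" by blast
  have "\<not> ?L U < ?L V" if "dd_maps_to m n \<pi> (T2 m)" using that by (simp add: dd_maps_to_def)
  with T2 bit lehmer_weight_cases[of "map \<pi> [1..<Suc (m + n)]"]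
  show "dd_maps_to m n \<pi> (T2 m) \<longleftrightarrow> ?W = -1" by auto
qed

section \<open>Evaluation of the signed count\<close>

text \<open>For \<open>k \<ge> n\<close> the \<open>k - n + 1\<close> entries
  \<open>c \<le> k - n\<close> contribute \<open>1\<close> each, the other \<open>n\<close>
  contribute \<open>-1\<close>.\<close>

lemma sum_w: "(\<Sum>c\<le>k. w k c) = (if k < n then int (Suc k) else int (Suc (k - n)) - int n)"
proof (cases "k < n")
  case True
  then show ?thesis by (simp add: w_def)
next
  case False
  then obtain d where d: "k = n + d" by (metis le_Suc_ex not_less)
  have "{..k} = {..d} \<union> {d<..k}" using d by auto
  then have "(\<Sum>c\<le>k. w k c) = (\<Sum>c\<le>d. w k c) + (\<Sum>c\<in>{d<..k}. w k c)"
    by (simp only:) (rule sum.union_disjoint; auto)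
  also have "(\<Sum>c\<le>d. w k c) = int (Suc d)" by (simp add: w_def d)
  also have "(\<Sum>c\<in>{d<..k}. w k c) = - int n" by (simp add: w_def d)
  finally show ?thesis using d by simp
qed

text \<open>Reversing all signs turns the product into the falling factorial of \<open>n - 1\<close>
  with \<open>k\<close> factors.\<close>

lemma prod_shifted_eq_binomial:
  "(\<Prod>i<k. int (Suc i) - int n) = (-1) ^ k * int ((n - 1) choose k) * fact k"
proof (induction k)
  case 0
  then show ?case by simp
next
  case (Suc k)
  have "int (Suc k * ((n - 1) choose Suc k)) = (int n - int (Suc k)) * int ((n - 1) choose k)"
  \<comment> \<open>In the first case the natural subtraction \<open>n - 1 - k\<close> is exact; in
    the other both binomials are zero.\<close>
  proof (cases "k \<le> n - 1")
    case True
    have "Suc k * ((n - 1) choose Suc k) = (n - 1 - k) * ((n - 1) choose k)"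
      by (metis binomial_absorb_comp binomial_absorption)
    then show ?thesis using True n by (simp add: of_nat_diff)
  qed (simp add: binomial_eq_0)
  then have c: "int (Suc k) * int ((n - 1) choose Suc k) = (int n - int (Suc k)) * int ((n - 1) choose k)"
    by (simp only: of_nat_mult)
  have "(\<Prod>i<Suc k. int (Suc i) - int n)
      = - ((-1) ^ k * fact k * ((int n - int (Suc k)) * int ((n - 1) choose k)))"
    unfolding prod.lessThan_Suc Suc.IH by algebra
  also have "\<dots> = (-1) ^ Suc k * int ((n - 1) choose Suc k) * fact (Suc k)"
    unfolding c[symmetric] by simp
  finally show ?case .
qed

lemma prod_sum_w:
  "(\<Prod>k<m + n. \<Sum>c\<le>k. w k c) = (-1) ^ m * int ((n - 1) choose m) * fact m * fact n"
proof -
  have "(\<Prod>k<m + n. \<Sum>c\<le>k. w k c)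
      = (\<Prod>k<n. \<Sum>c\<le>k. w k c) * (\<Prod>k<m. \<Sum>c\<le>n + k. w (n + k) c)"
    by (induction m) (simp_all add: add.commute mult_ac)
  also have "(\<Prod>k<n. \<Sum>c\<le>k. w k c) = (\<Prod>k<n. int (Suc k))"
    by (rule prod.cong) (simp_all add: sum_w)
  also have "\<dots> = fact n"
    by (induction n) (simp_all add: algebra_simps)
  also have "(\<Prod>k<m. \<Sum>c\<le>n + k. w (n + k) c) = (\<Prod>i<m. int (Suc i) - int n)"
    by (rule prod.cong) (simp_all add: sum_w)
  finally show ?thesis unfolding prod_shifted_eq_binomial by (simp add: mult_ac)
qed

text \<open>Each weight is \<open>1\<close> or \<open>-1\<close> according to the output, so the
  signed count is the sum of all weights.\<close>

lemma s1_minus_s2: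
  "int (s1 m n) - int (s2 m n) = (-1) ^ m * int ((n - 1) choose m) * fact m * fact n"
proof -
  let ?W = "\<lambda>\<pi>. lehmer_weight w (map \<pi> [1..<Suc (m + n)])"
  let ?X = "{\<pi>. \<pi> permutes {1..m + n}}"
  have fin: "finite ?X" by (simp add: finite_permutations)
  have s: "s1 m n = card {\<pi>\<in>?X. ?W \<pi> = 1}" "s2 m n = card {\<pi>\<in>?X. ?W \<pi> = -1}"
    unfolding s1_def s2_def using dd_maps_to_iff
    by (auto intro!: arg_cong[of _ _ card] simp del: upt_Suc)
  have "?W \<pi> = of_bool (?W \<pi> = 1) - of_bool (?W \<pi> = -1)" for \<pi> :: "nat \<Rightarrow> nat"
    using lehmer_weight_cases[of "map \<pi> [1..<Suc (m + n)]"] by auto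
  then have "(\<Sum>\<pi>\<in>?X. ?W \<pi>) = (\<Sum>\<pi>\<in>?X. of_bool (?W \<pi> = 1) - of_bool (?W \<pi> = -1))"
    by (intro sum.cong refl)
  also have "\<dots> = int (s1 m n) - int (s2 m n)"
    using fin by (simp add: s sum_subtractf Int_def del: upt_Suc)
  finally have "int (s1 m n) - int (s2 m n) = (\<Sum>\<pi>\<in>?X. ?W \<pi>)" ..
  also have "\<dots> = (\<Sum>xs\<in>permutations_of_set {1..m + n}. lehmer_weight w xs)"
    by (rule sum.reindex_bij_betw[OF bij_betw_permutes_permutations_of_set])
  also have "\<dots> = (\<Prod>k<m + n. \<Sum>c\<le>k. w k c)" by (simp add: sum_lehmer_weight)
  finally show ?thesis unfolding prod_sum_w .
qed

end

theorem theorem1p1: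
  fixes m n :: nat
  assumes "m \<ge> 2" and "n \<ge> 2"
  shows "(\<forall>\<pi>. \<pi> permutes {1..m + n} \<longrightarrow> dd_maps_to m n \<pi> (T1 m) \<or> dd_maps_to m n \<pi> (T2 m))
    \<and> int (s1 m n) - int (s2 m n) = (-1) ^ m * int ((n - 1) choose m) * fact m * fact n
    \<and> (s1 m n = s2 m n \<longleftrightarrow> m \<ge> n)"
proof -
  interpret double_tailed m n using assms by unfold_locales
  have "s1 m n = s2 m n \<longleftrightarrow> int (s1 m n) - int (s2 m n) = 0" by simp
  \<comment> \<open>Only the binomial coefficient can vanish, and it does iff
    \<open>n - 1 < m\<close>.\<close>
  also have "\<dots> \<longleftrightarrow> m \<ge> n"
    unfolding s1_minus_s2 using assms by (auto simp: binomial_eq_0_iff)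
  finally show ?thesis
    using s1_minus_s2 dd_maps_to_iff lehmer_weight_cases by blast
qed

end
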